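(* Let $\mathcal{P}\subset\mathbb{R}^n$ be a pure $n$-dimensional hereditary polytopal complex, $r\ge0$ an integer, and $P\subset R=\mathbb{R}[x_1,\dots,x_n]$ a prime ideal. Let $W\in L_{\mathcal{P}}$ be the unique flat with $\mathcal{P}_W=\mathcal{P}_P$. Then, as submodules of $\bigoplus_{\sigma\in\mathcal{P}_n}R_P$, $$C^r(\mathcal{P})_P=C^r(\mathcal{P}_P)_P\oplus\bigoplus_{\sigma\in\mathcal{P}_n\setminus(\mathcal{P}_P)_n}R_P=C^r(\mathcal{P}_W)_P\oplus\bigoplus_{\sigma\in\mathcal{P}_n\setminus(\mathcal{P}_W)_n}R_P .$$
   Context: A polytopal complex $\mathcal{P}\subset\mathbb{R}^n$ is a finite set of convex polytopes (faces) such that every face of a member is a member and the intersection of any two members is a (possibly empty) face of both. It is pure $n$-dimensional if all its maximal faces (called facets) have dimension $n$. $\mathcal{P}_i$ is the set of $i$-faces and $\mathcal{P}_i^0$ the set of interior $i$-faces (an $(n-1)$-face is interior iff it lies in two facets). $G(\mathcal{P})$ is the graph on the facets in which $\sigma,\sigma'$ are adjacent iff $\sigma\cap\sigma'\in\mathcal{P}_{n-1}$. The star $\mathrm{st}(\gamma)$ of a face $\gamma$ is the subcomplex of all faces of facets containing $\gamma$. $\mathcal{P}$ is hereditary if $G(\mathrm{st}(\gamma))$ is connected for every nonempty $\gamma\in\mathcal{P}$. For $\tau\in\mathcal{P}_{n-1}$, $\mathrm{aff}(\tau)$ is its affine span and $l_\tau\in R$ a degree-one polynomial generating the ideal of $\mathrm{aff}(\tau)$.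 $C^r(\mathcal{P})$ is the $R$-module of piecewise polynomial functions on $\mathcal{P}$ continuously differentiable of order $r$, identified with the tuples $(F_\sigma)\in\bigoplus_{\sigma\in\mathcal{P}_n}R$ such that $l_\tau^{r+1}$ divides $F_\sigma-F_{\sigma'}$ whenever $\sigma\cap\sigma'=\tau\in\mathcal{P}_{n-1}$. $L_{\mathcal{P}}$ is the set of flats, i.e. nonempty intersections of the hyperplanes $\mathrm{aff}(\tau)$, $\tau\in\mathcal{P}_{n-1}^0$, including $\mathbb{R}^n$ (empty intersection). For an ideal $J\subset R$ containing $l_\tau$ for some $\tau\in\mathcal{P}_{n-1}^0$, let $G_J(\mathcal{P})$ be the graph whose vertices are the facets having an interior $(n-1)$-face $\tau$ with $l_\tau\in J$, with $\sigma_1,\sigma_2$ adjacent iff $\sigma_1\cap\sigma_2=\tau\in\mathcal{P}_{n-1}$ with $l_\tau\in J$. If $J$ contains no such $l_\tau$, let $G_J(\mathcal{P})$ have all facets as vertices and no edges. For each connected component $G_J^i(\mathcal{P})$ let $\mathcal{P}_J^i$ be the complex consisting of the facets in $G_J^i(\mathcal{P})$ glued along the $(n-1)$-faces $\tau$ corresponding to the edges of $G_J^i(\mathcal{P})$ (so its dual graph is $G_J^i(\mathcal{P})$); $\mathcal{P}_J$ is the disjoint union of the $\mathcal{P}_J^i$, and $(\mathcal{P}_J)_n$ its set of facets. Two such complexes $\mathcal P_J,\mathcal P_{J'}$ are equal iff $G_J(\mathcal P)=G_{J'}(\mathcal P)$. $C^r(\mathcal{P}_J^i)$ is the module of tuples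 $(F_\sigma)$ indexed by the facets of $\mathcal{P}_J^i$ with $l_\tau^{r+1}\mid F_\sigma-F_{\sigma'}$ for each edge $\{\sigma,\sigma'\}$ of $G_J^i(\mathcal{P})$, $\tau=\sigma\cap\sigma'$; and $C^r(\mathcal{P}_J)=\bigoplus_iC^r(\mathcal{P}_J^i)$, regarded inside $\bigoplus_{\sigma\in\mathcal{P}_n}R$ by extending by zero. For $W\in L_{\mathcal{P}}$, $\mathcal{P}_W:=\mathcal{P}_{I(W)}$ with $I(W)$ the ideal of polynomials vanishing on $W$. For a prime $P$, the unique $W\in L_{\mathcal P}$ with $\mathcal{P}_W=\mathcal{P}_P$ is the intersection of all $\mathrm{aff}(\tau)$, $\tau\in\mathcal{P}_{n-1}^0$, with $l_\tau\in P$. The subscript $P$ on modules and on $R$ denotes localization at $P$. *)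

theory Defs
  imports
    "HOL-Analysis.Analysis"
    "HOL-Library.Poly_Mapping"
    "HOL-Computational_Algebra.Fraction_Field"
    "HOL-Algebra.Algebraic_Closure_Type"
begin

unbundle no fps_syntax

section \<open>The polynomial ring\<close>

text \<open>
  \<open>R = \<real>[x\<^sub>1,\<dots>,x\<^sub>n]\<close> with the variables indexed by a finite type \<open>'n\<close>; an element maps
  each exponent vector to its coefficient. The order on \<open>'n\<close> plays no mathematical role: the
  library needs it to make this type an integral domain.
\<close>

type_synonym 'n mpoly = "('n \<Rightarrow>\<^sub>0 nat) \<Rightarrow>\<^sub>0 real"

definition mpoly_eval :: "'n::finite mpoly \<Rightarrow> real ^ 'n \<Rightarrow> real" where
  "mpoly_eval p x =
     (\<Sum>m \<in> Poly_Mapping.keys p.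
        Poly_Mapping.lookup p m * (\<Prod>i\<in>UNIV. (x $ i) ^ Poly_Mapping.lookup m i))"

text \<open>The zero polynomial gets degree 0.\<close>

definition total_degree :: "'n::finite mpoly \<Rightarrow> nat" where
  "total_degree p =
     Max (insert 0 ((\<lambda>m. \<Sum>i\<in>UNIV. Poly_Mapping.lookup m i) ` Poly_Mapping.keys p))"

definition vanishing_ideal :: "(real ^ 'n::finite) set \<Rightarrow> 'n mpoly set" where
  "vanishing_ideal S = {p. \<forall>x\<in>S. mpoly_eval p x = 0}"

definition prime_ideal :: "'a::comm_ring_1 set \<Rightarrow> bool" where
  "prime_ideal P \<longleftrightarrow> primeideal P (ring_of_type_algebra :: 'a ring)"


section \<open>Polytopal complexes\<close>

text \<open>The empty set is a face of every polytope, of dimension \<open>-1\<close>.\<close>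

definition polytopal_complex :: "'a::euclidean_space set set \<Rightarrow> bool" where
  "polytopal_complex \<P> \<longleftrightarrow>
     finite \<P> \<and>
     (\<forall>S\<in>\<P>. polytope S) \<and>
     (\<forall>S\<in>\<P>. \<forall>F. F face_of S \<longrightarrow> F \<in> \<P>) \<and>
     (\<forall>S\<in>\<P>. \<forall>S'\<in>\<P>. (S \<inter> S') face_of S \<and> (S \<inter> S') face_of S')"

definition faces_of_dim :: "'a::euclidean_space set set \<Rightarrow> int \<Rightarrow> 'a set set" where
  "faces_of_dim \<P> i = {\<tau>\<in>\<P>. aff_dim \<tau> = i}"

definition facets :: "'a set set \<Rightarrow> 'a set set" where
  "facets \<P> = {\<sigma>\<in>\<P>. \<forall>\<sigma>'\<in>\<P>. \<sigma> \<subseteq> \<sigma>' \<longrightarrow> \<sigma> = \<sigma>'}"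

definition pure_full_dim :: "'a::euclidean_space set set \<Rightarrow> bool" where
  "pure_full_dim \<P> \<longleftrightarrow> (\<forall>\<sigma>\<in>facets \<P>. aff_dim \<sigma> = int DIM('a))"

text \<open>The \<open>n\<close>-faces and the \<open>(n-1)\<close>-faces, \<open>n\<close> being the dimension of the ambient space.\<close>

abbreviation top_faces :: "'a::euclidean_space set set \<Rightarrow> 'a set set" where
  "top_faces \<P> \<equiv> faces_of_dim \<P> (int DIM('a))"

abbreviation walls :: "'a::euclidean_space set set \<Rightarrow> 'a set set" where
  "walls \<P> \<equiv> faces_of_dim \<P> (int DIM('a) - 1)"

definition interior_walls :: "'a::euclidean_space set set \<Rightarrow> 'a set set" where
  "interior_walls \<P> =
     {\<tau>\<in>walls \<P>. \<exists>\<sigma>\<in>facets \<P>. \<exists>\<sigma>'\<in>facets \<P>. \<sigma> \<noteq> \<sigma>' \<and> \<tau> face_of \<sigma> \<and> \<tau> face_of \<sigma>'}"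

definition star :: "'a::euclidean_space set set \<Rightarrow> 'a set \<Rightarrow> 'a set set" where
  "star \<P> \<gamma> = {\<tau>. \<exists>\<sigma>\<in>facets \<P>. \<gamma> \<subseteq> \<sigma> \<and> \<tau> face_of \<sigma>}"


section \<open>Graphs\<close>

text \<open>
  Undirected graphs: \<open>adj\<close> is a symmetric relation on \<open>verts\<close> in all uses below.
\<close>

record 'v ugraph =
  verts :: "'v set"
  adj :: "('v \<times> 'v) set"

definition graph_connected :: "'v ugraph \<Rightarrow> bool" where
  "graph_connected G \<longleftrightarrow> (\<forall>u\<in>verts G. \<forall>v\<in>verts G. (u, v) \<in> (adj G)\<^sup>*)"

definition graph_components :: "'v ugraph \<Rightarrow> 'v set set" where
  "graph_components G =
     verts G // {(u, v). u \<in> verts G \<and> v \<in> verts G \<and> (u, v) \<in> (adj G)\<^sup>*}"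

definition dual_graph :: "'a::euclidean_space set set \<Rightarrow> 'a set ugraph" where
  "dual_graph \<P> =
     \<lparr> verts = facets \<P>,
       adj = {(\<sigma>, \<sigma>'). \<sigma> \<in> facets \<P> \<and> \<sigma>' \<in> facets \<P> \<and> \<sigma> \<inter> \<sigma>' \<in> walls \<P>} \<rparr>"

definition hereditary :: "'a::euclidean_space set set \<Rightarrow> bool" where
  "hereditary \<P> \<longleftrightarrow> (\<forall>\<gamma>\<in>\<P>. \<gamma> \<noteq> {} \<longrightarrow> graph_connected (dual_graph (star \<P> \<gamma>)))"


section \<open>Hyperplanes and flats\<close>

text \<open>
  \<open>l \<tau>\<close> is only determined up to a nonzero scalar; a choice of all the \<open>l \<tau>\<close> is carried as a
  parameter.
\<close>

definition defining_forms ::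
    "(real ^ 'n::finite) set set \<Rightarrow> ((real ^ 'n) set \<Rightarrow> 'n mpoly) \<Rightarrow> bool" where
  "defining_forms \<P> l \<longleftrightarrow>
     (\<forall>\<tau>\<in>walls \<P>. total_degree (l \<tau>) = 1 \<and>
        vanishing_ideal (affine hull \<tau>) = {q * l \<tau> | q. True})"

definition flats :: "'a::euclidean_space set set \<Rightarrow> 'a set set" where
  "flats \<P> = {W. W \<noteq> {} \<and> (\<exists>T\<subseteq>interior_walls \<P>. W = (\<Inter>\<tau>\<in>T. affine hull \<tau>))}"


section \<open>The complexes \<open>\<P>\<^sub>J\<close>\<close>

text \<open>
  The graph \<open>G\<^sub>J(\<P>)\<close>. It determines the complex \<open>\<P>\<^sub>J\<close>, which is represented by it: equality of
  such complexes is equality of the graphs, and the facets of \<open>\<P>\<^sub>J\<close> are the vertices.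
\<close>

definition graph_at ::
    "(real ^ 'n::finite) set set \<Rightarrow> ((real ^ 'n) set \<Rightarrow> 'n mpoly) \<Rightarrow> 'n mpoly set
      \<Rightarrow> (real ^ 'n) set ugraph" where
  "graph_at \<P> l J =
     (if \<exists>\<tau>\<in>interior_walls \<P>. l \<tau> \<in> J then
        \<lparr> verts = {\<sigma>\<in>facets \<P>. \<exists>\<tau>\<in>interior_walls \<P>. \<tau> face_of \<sigma> \<and> l \<tau> \<in> J},
          adj = {(\<sigma>, \<sigma>'). \<sigma> \<in> facets \<P> \<and> \<sigma>' \<in> facets \<P> \<and>
                   \<sigma> \<inter> \<sigma>' \<in> walls \<P> \<and> l (\<sigma> \<inter> \<sigma>') \<in> J} \<rparr>
      else \<lparr> verts = facets \<P>, adj = {} \<rparr>)"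


section \<open>Spline modules\<close>

text \<open>
  The direct sum over \<open>S\<close> of copies of \<open>A\<close>, extended by zero outside the finite index set \<open>S\<close>.
\<close>

definition tuples :: "'b::zero set \<Rightarrow> 'v set \<Rightarrow> ('v \<Rightarrow> 'b) set" where
  "tuples A S = {F. (\<forall>\<sigma>\<in>S. F \<sigma> \<in> A) \<and> (\<forall>\<sigma>. \<sigma> \<notin> S \<longrightarrow> F \<sigma> = 0)}"

definition splines ::
    "nat \<Rightarrow> (real ^ 'n::finite) set set \<Rightarrow> ((real ^ 'n) set \<Rightarrow> 'n mpoly)
      \<Rightarrow> ((real ^ 'n) set \<Rightarrow> 'n mpoly) set" where
  "splines r \<P> l =
     {F \<in> tuples UNIV (top_faces \<P>).
        \<forall>\<sigma>\<in>top_faces \<P>. \<forall>\<sigma>'\<in>top_faces \<P>. \<sigma> \<inter> \<sigma>' \<in> walls \<P> \<longrightarrow>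
          l (\<sigma> \<inter> \<sigma>') ^ (r + 1) dvd F \<sigma> - F \<sigma>'}"

text \<open>\<open>C\<^sup>r\<close> of the piece of \<open>\<P>\<^sub>J\<close> whose facets form the component \<open>K\<close> of \<open>G = G\<^sub>J(\<P>)\<close>.\<close>

definition component_splines ::
    "nat \<Rightarrow> ((real ^ 'n::finite) set \<Rightarrow> 'n mpoly) \<Rightarrow> (real ^ 'n) set ugraph
      \<Rightarrow> (real ^ 'n) set set \<Rightarrow> ((real ^ 'n) set \<Rightarrow> 'n mpoly) set" where
  "component_splines r l G K =
     {F \<in> tuples UNIV K.
        \<forall>\<sigma>\<in>K. \<forall>\<sigma>'\<in>K. (\<sigma>, \<sigma>') \<in> adj G \<longrightarrow> l (\<sigma> \<inter> \<sigma>') ^ (r + 1) dvd F \<sigma> - F \<sigma>'}"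

text \<open>
  \<open>C\<^sup>r(\<P>\<^sub>J)\<close> for \<open>G = G\<^sub>J(\<P>)\<close>; the sum over the components is direct because tuples belonging
  to different components have disjoint supports.
\<close>

definition graph_splines ::
    "nat \<Rightarrow> ((real ^ 'n::finite) set \<Rightarrow> 'n mpoly) \<Rightarrow> (real ^ 'n) set ugraph
      \<Rightarrow> ((real ^ 'n) set \<Rightarrow> 'n mpoly) set" where
  "graph_splines r l G =
     {(\<lambda>\<sigma>. \<Sum>K\<in>graph_components G. F K \<sigma>) | F.
        \<forall>K\<in>graph_components G. F K \<in> component_splines r l G K}"


section \<open>Localization\<close>

text \<open>
  For a prime \<open>P\<close> of a domain \<open>R\<close>, the local ring and the localizations of submodules of
  \<open>\<Oplus>\<^bsub>\<sigma>\<^esub> R\<close> are taken inside the fraction field, respectively in tuples over it. By exactness of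
  localization, the localization of such a submodule \<open>M\<close> is the set of fractions \<open>F / s\<close> with
  \<open>F\<close> in \<open>M\<close> and \<open>s\<close> outside \<open>P\<close>.
\<close>

definition local_ring :: "'a::idom set \<Rightarrow> 'a fract set" where
  "local_ring P = {Fract f s | f s. s \<notin> P}"

definition local_module :: "'a::idom set \<Rightarrow> ('v \<Rightarrow> 'a) set \<Rightarrow> ('v \<Rightarrow> 'a fract) set" where
  "local_module P M = {(\<lambda>\<sigma>. Fract (F \<sigma>) s) | F s. F \<in> M \<and> s \<notin> P}"

definition is_direct_sum ::
    "('v \<Rightarrow> 'b::comm_monoid_add) set \<Rightarrow> ('v \<Rightarrow> 'b) set \<Rightarrow> ('v \<Rightarrow> 'b) set \<Rightarrow> bool" where
  "is_direct_sum M A B \<longleftrightarrow>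
     M = {(\<lambda>\<sigma>. F \<sigma> + G \<sigma>) | F G. F \<in> A \<and> G \<in> B} \<and> A \<inter> B = {\<lambda>\<sigma>. 0}"

end

theory Submission
  imports Defs
begin

text \<open>
  Fractions are put over the common denominator \<open>u = \<Prod> l \<tau> ^ (r + 1)\<close>, the product being over the
  interior walls \<open>\<tau>\<close> with \<open>l \<tau> \<notin> P\<close>. It lies outside \<open>P\<close>, and multiplication by \<open>u\<close> enforces all
  smoothness conditions other than those along the edges of \<open>G\<^sub>P(\<P>)\<close>.

  The flat is the intersection \<open>W\<close> of the \<open>aff(\<tau>)\<close> with \<open>l \<tau> \<in> P\<close>. An affine function that vanishes
  on the nonempty solution set of a linear system is a linear combination of the equations, and if
  the solution set is empty then so is the constant 1. Since \<open>1 \<notin> P\<close>, this shows both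
  \<open>W \<noteq> {}\<close> and that \<open>l \<tau> \<in> I(W)\<close> implies \<open>l \<tau> \<in> P\<close>.
\<close>

section \<open>Prime ideals and localization\<close>

lemma prime_ideal_rules:
  assumes "prime_ideal (P :: 'a::comm_ring_1 set)"
  shows prime_ideal_zero: "0 \<in> P"
    and prime_ideal_one: "1 \<notin> P"
    and prime_ideal_add: "\<And>x y. x \<in> P \<Longrightarrow> y \<in> P \<Longrightarrow> x + y \<in> P"
    and prime_ideal_mult: "\<And>x y. y \<in> P \<Longrightarrow> x * y \<in> P"
    and prime_ideal_prime: "\<And>x y. x * y \<in> P \<Longrightarrow> x \<in> P \<or> y \<in> P"
proof -
  interpret primeideal P "ring_of_type_algebra :: 'a ring"
    using assms by (simp add: prime_ideal_def)
  show "0 \<in> P" "\<And>x y. x \<in> P \<Longrightarrow> y \<in> P \<Longrightarrow> x + y \<in> P"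
    using additive_subgroup.zero_closed[OF additive_subgroup_axioms]
      additive_subgroup.a_closed[OF additive_subgroup_axioms]
    by (auto simp: ring_of_type_algebra_def)
  show "1 \<notin> P"
    using one_imp_carrier I_notcarr by (auto simp: ring_of_type_algebra_def)
  show "y \<in> P \<Longrightarrow> x * y \<in> P" for x y
    using I_l_closed[of y x] by (simp add: ring_of_type_algebra_def)
  show "x * y \<in> P \<Longrightarrow> x \<in> P \<or> y \<in> P" for x y
    using I_prime[of x y] by (simp add: ring_of_type_algebra_def)
qed

lemma prime_ideal_prod:
  assumes "prime_ideal P" "\<And>i. i \<in> I \<Longrightarrow> f i \<notin> P"
  shows "(\<Prod>i\<in>I. f i) \<notin> P"
  using assms(2)
  by (induction I rule: infinite_finite_induct)
    (auto simp: prime_ideal_one[OF assms(1)] dest: prime_ideal_prime[OF assms(1)])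

lemma prime_ideal_power:
  assumes "prime_ideal P" "x \<notin> P"
  shows "x ^ n \<notin> P"
  using prime_ideal_prod[OF assms(1), of "{..<n}" "\<lambda>_. x"] assms(2) by simp

section \<open>Common denominators and localization of direct sums\<close>

lemma local_moduleI: "F \<in> M \<Longrightarrow> s \<notin> P \<Longrightarrow> (\<lambda>\<sigma>. Fract (F \<sigma>) s) \<in> local_module P M"
  unfolding local_module_def by blast

text \<open>Finitely many denominators have their product as a common denominator, and primality
  keeps it outside \<open>P\<close>. This turns the free summand into a localization, so that both
  summands have the same form.\<close>

lemma tuples_local_ring:
  fixes P :: "'a::idom set"
  assumes P: "prime_ideal P" and S: "finite S"
  shows "tuples (local_ring P) S = local_module P (tuples UNIV S)"
proof (intro Set.set_eqI iffI)
  fix G :: "'b \<Rightarrow> 'a fract"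
  assume G: "G \<in> tuples (local_ring P) S"
  then have "\<forall>\<sigma>\<in>S. \<exists>a b. G \<sigma> = Fract a b \<and> b \<notin> P"
    by (auto simp: tuples_def local_ring_def)
  then obtain a b where ab: "\<And>\<sigma>. \<sigma> \<in> S \<Longrightarrow> G \<sigma> = Fract (a \<sigma>) (b \<sigma>) \<and> b \<sigma> \<notin> P"
    by metis
  \<comment> \<open>Each numerator is expanded by the other denominators. The value 0 off
    \<open>S\<close> stays 0 over any denominator.\<close>
  define g where "g \<sigma> = (if \<sigma> \<in> S then (\<Prod>\<rho>\<in>S - {\<sigma>}. b \<rho>) * a \<sigma> else 0)" for \<sigma>
  define s where "s = (\<Prod>\<rho>\<in>S. b \<rho>)"
  have s: "s \<notin> P"
    unfolding s_def by (intro prime_ideal_prod[OF P]) (use ab in blast)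
  have "G \<sigma> = Fract (g \<sigma>) s" for \<sigma>
  proof (cases "\<sigma> \<in> S")
    case True
    have split: "s = (\<Prod>\<rho>\<in>S - {\<sigma>}. b \<rho>) * b \<sigma>"
      unfolding s_def using prod.remove[OF S True, of b] by (simp add: mult.commute)
    moreover have "s \<noteq> 0"
      using s prime_ideal_zero[OF P] by auto
    ultimately have "(\<Prod>\<rho>\<in>S - {\<sigma>}. b \<rho>) \<noteq> 0" by auto
    from mult_fract_cancel[OF this] show ?thesis
      using ab[OF True] True by (simp add: g_def split)
  next
    case False
    then show ?thesis using G by (simp add: g_def tuples_def fract_collapse)
  qed
  then have "G = (\<lambda>\<sigma>. Fract (g \<sigma>) s)" by blast
  moreover have "g \<in> tuples UNIV S"
    by (simp add: tuples_def g_def)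
  ultimately show "G \<in> local_module P (tuples UNIV S)"
    using s by (simp add: local_moduleI)
qed (auto simp: local_module_def tuples_def local_ring_def fract_collapse)

text \<open>\<open>M\<close> and the sum of \<open>A\<close> and the tuples on \<open>S\<close>
  agree once \<open>u\<close> is inverted: \<open>split\<close> cuts an element of \<open>M\<close>
  along the two disjoint supports, and \<open>clear\<close> brings any combination back into
  \<open>M\<close> at the cost of a factor \<open>u\<close>. The coefficients \<open>a\<close> and
  \<open>b\<close> in \<open>clear\<close> allow fractions with different denominators to be
  combined.\<close>

lemma is_direct_sum_local_module:
  fixes P :: "'a::idom set"
  assumes P: "prime_ideal P" and u: "u \<notin> P" and disj: "S \<inter> V = {}"
    and A: "A \<subseteq> tuples UNIV V" "(\<lambda>\<sigma>. 0) \<in> A"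
    and split: "\<And>F. F \<in> M \<Longrightarrow>
      (\<lambda>\<sigma>. if \<sigma> \<in> V then F \<sigma> else 0) \<in> A \<and> (\<forall>\<sigma>. \<sigma> \<notin> V \<union> S \<longrightarrow> F \<sigma> = 0)"
    and clear: "\<And>F G a b. F \<in> A \<Longrightarrow> G \<in> tuples UNIV S \<Longrightarrow> (\<lambda>\<sigma>. u * (a * F \<sigma> + b * G \<sigma>)) \<in> M"
  shows "is_direct_sum (local_module P M) (local_module P A) (local_module P (tuples UNIV S))"
  unfolding is_direct_sum_def
proof (intro conjI Set.set_eqI iffI)
  have nz: "s \<noteq> 0" if "s \<notin> P" for s
    using that prime_ideal_zero[OF P] by auto
  {
    fix H assume "H \<in> local_module P M"
    then obtain F s where F: "F \<in> M" "s \<notin> P" "H = (\<lambda>\<sigma>. Fract (F \<sigma>) s)"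
      by (auto simp: local_module_def)
    define F1 where "F1 = (\<lambda>\<sigma>. if \<sigma> \<in> V then F \<sigma> else 0)"
    define F2 where "F2 = (\<lambda>\<sigma>. if \<sigma> \<in> S then F \<sigma> else 0)"
    have "F1 \<in> A" "F2 \<in> tuples UNIV S"
      using split[OF F(1)] by (auto simp: F1_def F2_def tuples_def)
    then have mem: "(\<lambda>\<sigma>. Fract (F1 \<sigma>) s) \<in> local_module P A"
        "(\<lambda>\<sigma>. Fract (F2 \<sigma>) s) \<in> local_module P (tuples UNIV S)"
      by (simp_all add: local_moduleI F(2))
    have "H = (\<lambda>\<sigma>. Fract (F1 \<sigma>) s + Fract (F2 \<sigma>) s)"
    proof (unfold F(3), rule ext)
      show "Fract (F \<sigma>) s = Fract (F1 \<sigma>) s + Fract (F2 \<sigma>) s" for \<sigma>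
        using split[OF F(1)] disj by (auto simp: F1_def F2_def fract_collapse)
    qed
    then show "H \<in> {\<lambda>\<sigma>. F \<sigma> + G \<sigma> | F G.
        F \<in> local_module P A \<and> G \<in> local_module P (tuples UNIV S)}"
      using mem by (intro CollectI exI[of _ "\<lambda>\<sigma>. Fract (F1 \<sigma>) s"]
          exI[of _ "\<lambda>\<sigma>. Fract (F2 \<sigma>) s"] conjI)
  next
    fix H assume "H \<in> {\<lambda>\<sigma>. F \<sigma> + G \<sigma> | F G.
        F \<in> local_module P A \<and> G \<in> local_module P (tuples UNIV S)}"
    then obtain F s G t where *: "F \<in> A" "s \<notin> P" "G \<in> tuples UNIV S" "t \<notin> P"
        "H = (\<lambda>\<sigma>. Fract (F \<sigma>) s + Fract (G \<sigma>) t)"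
      by (auto simp: local_module_def)
    \<comment> \<open>Over the denominator \<open>s * t\<close> the sum has numerator
      \<open>t * F + s * G\<close>; expanding by \<open>u\<close> moves it into \<open>M\<close> by
      \<open>clear\<close>.\<close>
    have "H = (\<lambda>\<sigma>. Fract (u * (t * F \<sigma> + s * G \<sigma>)) (u * (s * t)))"
      unfolding mult_fract_cancel[OF nz[OF u]]
      using nz[OF *(2)] nz[OF *(4)] by (simp add: *(5) mult.commute)
    moreover have "u * (s * t) \<notin> P"
      using u *(2,4) by (auto dest!: prime_ideal_prime[OF P])
    ultimately show "H \<in> local_module P M"
      using local_moduleI[OF clear[OF *(1,3), of t s]] by simp
  next
    fix H assume "H \<in> local_module P A \<inter> local_module P (tuples UNIV S)"
    then obtain F s G t where *: "F \<in> A" "H = (\<lambda>\<sigma>. Fract (F \<sigma>) s)"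
        "G \<in> tuples UNIV S" "H = (\<lambda>\<sigma>. Fract (G \<sigma>) t)"
      unfolding local_module_def by blast
    \<comment> \<open>\<open>F\<close> lives on \<open>V\<close> and \<open>G\<close> on
      \<open>S\<close>, so at each index one of the two representations of \<open>H\<close> has
      numerator 0.\<close>
    have "F \<sigma> = 0 \<or> G \<sigma> = 0" for \<sigma>
      using * disj A(1) by (auto simp: tuples_def)
    then have "H \<sigma> = 0" for \<sigma>
      using *(2,4) by (metis fract_collapse(1))
    then show "H \<in> {\<lambda>\<sigma>. 0}" by auto
  next
    fix H :: "'b \<Rightarrow> 'a fract" assume "H \<in> {\<lambda>\<sigma>. 0}"
    then have H: "H = (\<lambda>\<sigma>. Fract ((\<lambda>\<sigma>. 0) \<sigma>) 1)" by (simp add: fract_collapse)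
    have "(\<lambda>\<sigma>. 0) \<in> tuples UNIV S" by (simp add: tuples_def)
    then show "H \<in> local_module P A \<inter> local_module P (tuples UNIV S)"
      unfolding H by (intro IntI local_moduleI A(2) prime_ideal_one[OF P])
  }
qed


section \<open>Affine functions\<close>

text \<open>The pair \<open>(a, b)\<close> stands for the affine function \<open>x \<mapsto> a \<bullet> x + b\<close>.\<close>

definition affine_form :: "(real ^ 'n::finite) \<times> real \<Rightarrow> 'n mpoly" where
  "affine_form v =
     (\<Sum>i\<in>UNIV. Poly_Mapping.single (Poly_Mapping.single i 1) (fst v $ i)) +
     Poly_Mapping.single 0 (snd v)"

lemma single_1_neq_0: "Poly_Mapping.single i (1::nat) \<noteq> 0"
  by (metis lookup_single_eq lookup_zero zero_neq_one)

lemma single_1_eq_iff: "Poly_Mapping.single i (1::nat) = Poly_Mapping.single j 1 \<longleftrightarrow> i = j"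
  by (metis lookup_single_eq lookup_single_not_eq zero_neq_one)

lemma lookup_affine_form_0: "Poly_Mapping.lookup (affine_form v) 0 = snd v"
  by (simp add: affine_form_def lookup_add lookup_sum lookup_single single_1_neq_0 del: One_nat_def)

lemma lookup_affine_form_single:
  "Poly_Mapping.lookup (affine_form v) (Poly_Mapping.single i 1) = fst v $ i"
  using single_1_neq_0[of i]
  by (simp add: affine_form_def lookup_add lookup_sum lookup_single single_1_eq_iff when_def
      del: One_nat_def)

lemma lookup_affine_form_other:
  assumes "m \<noteq> 0" "\<And>i. m \<noteq> Poly_Mapping.single i 1"
  shows "Poly_Mapping.lookup (affine_form v) m = 0"
  using assms
  by (simp add: affine_form_def lookup_add lookup_sum lookup_single when_def eq_commute[of _ m])

lemma affine_form_add: "affine_form (v + w) = affine_form v + affine_form w"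
  by (simp add: affine_form_def single_add sum.distrib algebra_simps)

lemma affine_form_scaleR:
  "affine_form (c *\<^sub>R v) = Poly_Mapping.single 0 c * affine_form v"
  by (simp add: affine_form_def mult_single sum_distrib_left distrib_left)

text \<open>Pairing with \<open>(x, 1)\<close> homogenizes: affine equations in \<open>x\<close>
  become linear conditions, so that orthogonality of coefficient pairs can be used.\<close>

lemma mpoly_eval_affine_form:
  fixes v :: "(real ^ 'n::finite) \<times> real"
  shows "mpoly_eval (affine_form v) x = v \<bullet> (x, 1)"
proof -
  define p where "p = affine_form v"
  \<comment> \<open>The constant monomial and the variables contain the support of \<open>p\<close>;
    the terms added to the sum have coefficient 0.\<close>
  define M where "M = insert 0 (range (\<lambda>i::'n. Poly_Mapping.single i (1::nat)))"
  let ?t = "\<lambda>m. Poly_Mapping.lookup p m * (\<Prod>i\<in>UNIV. (x $ i) ^ Poly_Mapping.lookup m i)"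
  have "m \<in> M" if "m \<in> Poly_Mapping.keys p" for m
    using that lookup_affine_form_other[of m v] by (auto simp: M_def p_def in_keys_iff)
  then have "mpoly_eval p x = sum ?t M"
    unfolding mpoly_eval_def
    by (intro sum.mono_neutral_left) (auto simp: M_def in_keys_iff simp del: One_nat_def)
  also have "\<dots> = ?t 0 + (\<Sum>m\<in>range (\<lambda>i::'n. Poly_Mapping.single i 1). ?t m)"
    unfolding M_def using single_1_neq_0[where ?'a = 'n]
    by (subst sum.insert) (auto simp del: One_nat_def simp: image_iff eq_commute[of 0])
  also have "(\<Sum>m\<in>range (\<lambda>i::'n. Poly_Mapping.single i 1). ?t m) =
      (\<Sum>i\<in>UNIV. ?t (Poly_Mapping.single i 1))"
    by (subst sum.reindex) (auto simp: inj_on_def single_1_eq_iff simp del: One_nat_def)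
  also have "\<dots> = (\<Sum>i\<in>UNIV. fst v $ i * x $ i)"
  proof (intro sum.cong refl)
    fix i :: 'n
    have "(\<Prod>j\<in>UNIV. (x $ j) ^ Poly_Mapping.lookup (Poly_Mapping.single i 1) j) =
        (\<Prod>j\<in>UNIV. if j = i then x $ j else 1)"
      by (intro prod.cong) (auto simp: lookup_single when_def)
    then show "?t (Poly_Mapping.single i 1) = fst v $ i * x $ i"
      using lookup_affine_form_single[of v i] by (simp add: p_def)
  qed
  also have "?t 0 = snd v"
    by (simp add: p_def lookup_affine_form_0)
  finally show ?thesis
    by (simp add: p_def inner_prod_def inner_vec_def)
qed

text \<open>The only monomials of degree at most 1 are 1 and the variables, so the required pair is
  read off from their coefficients.\<close>

lemma total_degree_le_1_imp_affine_form:
  fixes p :: "'n::finite mpoly"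
  assumes "total_degree p \<le> 1"
  obtains v where "p = affine_form v"
proof
  let ?v = "(\<chi> i. Poly_Mapping.lookup p (Poly_Mapping.single i 1), Poly_Mapping.lookup p 0)"
  show "p = affine_form ?v"
  proof (rule poly_mapping_eqI)
    fix m :: "'n \<Rightarrow>\<^sub>0 nat"
    consider "m = 0" | i where "m = Poly_Mapping.single i 1"
      | "m \<noteq> 0" "\<And>i. m \<noteq> Poly_Mapping.single i 1" by blast
    then show "Poly_Mapping.lookup p m = Poly_Mapping.lookup (affine_form ?v) m"
    proof cases
      case 3
      have "m \<notin> Poly_Mapping.keys p"
      proof
        assume "m \<in> Poly_Mapping.keys p"
        then have "(\<Sum>i\<in>UNIV. Poly_Mapping.lookup m i) \<le> total_degree p"
          unfolding total_degree_def by (intro Max_ge) auto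
        then have le: "(\<Sum>i\<in>UNIV. Poly_Mapping.lookup m i) \<le> 1"
          using assms by simp
        obtain i where i: "Poly_Mapping.lookup m i \<noteq> 0"
          using 3(1) by (metis lookup_zero poly_mapping_eqI)
        \<comment> \<open>A nonzero exponent at \<open>i\<close> uses up the whole degree, which
          makes \<open>m\<close> the variable with index \<open>i\<close>.\<close>
        have "Poly_Mapping.lookup m i + (\<Sum>j\<in>UNIV - {i}. Poly_Mapping.lookup m j) \<le> 1"
          using le by (simp add: sum.remove[of UNIV i])
        then have one: "Poly_Mapping.lookup m i = 1"
          and "(\<Sum>j\<in>UNIV - {i}. Poly_Mapping.lookup m j) = 0"
          using i by linarith+
        then have "Poly_Mapping.lookup m j = 0" if "j \<noteq> i" for j
          using that by simp
        then have "m = Poly_Mapping.single i 1"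
          using one by (intro poly_mapping_eqI) (auto simp: lookup_single when_def)
        with 3(2) show False by blast
      qed
      then show ?thesis
        using lookup_affine_form_other[OF 3] by (simp add: in_keys_iff)
    qed (simp_all add: lookup_affine_form_0 lookup_affine_form_single[simplified])
  qed
qed

section \<open>Consequences of systems of affine equations\<close>

lemma affine_form_in_span_in_ideal:
  assumes P: "prime_ideal P" and S: "\<And>v. v \<in> S \<Longrightarrow> affine_form v \<in> P" and v: "v \<in> span S"
  shows "affine_form v \<in> P"
  using v
proof (induction rule: span_induct_alt)
  case base
  show ?case
    using prime_ideal_zero[OF P] by (simp add: affine_form_def)
next
  case (step c x y)
  then show ?case
    using S P by (simp add: affine_form_add affine_form_scaleR prime_ideal_add prime_ideal_mult)
qed

text \<open>The part \<open>w\<close> of \<open>f\<close> orthogonal to the span is a homogeneous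
  solution of the system. Such a solution is a multiple of an actual solution or a direction along
  the solution set; either way \<open>f\<close> is orthogonal to \<open>w\<close>, which forces
  \<open>w = 0\<close>.\<close>

lemma affine_function_in_span:
  fixes S :: "('a::euclidean_space \<times> real) set"
  assumes z: "\<And>v. v \<in> S \<Longrightarrow> v \<bullet> (z, 1) = 0"
    and f: "\<And>x. (\<And>v. v \<in> S \<Longrightarrow> v \<bullet> (x, 1) = 0) \<Longrightarrow> f \<bullet> (x, 1) = 0"
  shows "f \<in> span S"
proof -
  obtain y w where y: "y \<in> span S" and w: "\<And>v. v \<in> span S \<Longrightarrow> orthogonal w v" and fyw: "f = y + w"
    by (rule orthogonal_subspace_decomp_exists[of S f]) blast
  obtain p t where wpt: "w = (p, t)" by (cases w)
  have vw: "v \<bullet> (p, t) = 0" if "v \<in> S" for v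
    using w[OF span_base[OF that]] by (simp add: wpt orthogonal_def inner_commute)
  have "f \<bullet> (p, t) = 0"
  \<comment> \<open>For \<open>t = 0\<close> the vector \<open>p\<close> is a direction, and
    translating the solution \<open>z\<close> by \<open>p\<close> gives another solution; otherwise
    \<open>p /\<^sub>R t\<close> is itself a solution.\<close>
  proof (cases "t = 0")
    case True
    have shift: "v \<bullet> (z + p, 1) = v \<bullet> (z, 1) + v \<bullet> (p, t)" for v :: "'a \<times> real"
      by (simp add: inner_prod_def inner_add_right True)
    have "f \<bullet> (z + p, 1) = 0"
      by (rule f) (simp only: shift z vw add_0)
    moreover have "f \<bullet> (z, 1) = 0"
      by (rule f) (rule z)
    ultimately show ?thesis by (simp only: shift add_0)
  next
    case False
    have scale: "v \<bullet> (p, t) = t * (v \<bullet> (p /\<^sub>R t, 1))" for v :: "'a \<times> real"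
      using False by (simp add: inner_prod_def algebra_simps)
    have "f \<bullet> (p /\<^sub>R t, 1) = 0"
      using vw False scale by (intro f) auto
    then show ?thesis by (simp only: scale mult_zero_right)
  qed
  moreover have "y \<bullet> w = 0"
    using w[OF y] by (simp add: orthogonal_def inner_commute)
  ultimately have "w = 0"
    by (simp add: fyw inner_add_left flip: wpt)
  with y fyw show ?thesis by simp
qed

text \<open>Let \<open>w = (p, t)\<close> be the part of \<open>(0, 1)\<close> orthogonal to the
  span. If \<open>t\<close> were nonzero, \<open>p /\<^sub>R t\<close> would solve the system; hence
  \<open>t = 0\<close>, and \<open>w \<bullet> w = w \<bullet> (0, 1) = t\<close> gives
  \<open>w = 0\<close>.\<close>

lemma one_in_span_if_inconsistent:
  fixes S :: "('a::euclidean_space \<times> real) set"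
  assumes "\<nexists>x. \<forall>v\<in>S. v \<bullet> (x, 1) = 0"
  shows "(0, 1) \<in> span S"
proof -
  obtain y w where y: "y \<in> span S" and w: "\<And>v. v \<in> span S \<Longrightarrow> orthogonal w v"
    and yw: "(0, 1) = y + w"
    by (rule orthogonal_subspace_decomp_exists[of S "(0, 1)"]) blast
  obtain p t where wpt: "w = (p, t)" by (cases w)
  have "t = 0"
  proof (rule ccontr)
    assume t: "t \<noteq> 0"
    have scale: "v \<bullet> w = t * (v \<bullet> (p /\<^sub>R t, 1))" for v :: "'a \<times> real"
      using t by (simp add: wpt inner_prod_def algebra_simps)
    have "v \<bullet> (p /\<^sub>R t, 1) = 0" if "v \<in> S" for v
      using w[OF span_base[OF that]] t scale[of v] by (simp add: orthogonal_def inner_commute)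
    with assms show False by blast
  qed
  moreover have "w \<bullet> (0, 1) = w \<bullet> w"
    using w[OF y] by (simp add: yw inner_add_right orthogonal_def)
  ultimately have "w = 0"
    by (simp add: wpt zero_prod_def)
  with y yw show ?thesis by simp
qed


section \<open>Walls and flats\<close>

lemma facets_Int_wall:
  fixes \<P> :: "'a::euclidean_space set set"
  assumes "polytopal_complex \<P>" "pure_full_dim \<P>" "\<sigma> \<in> facets \<P>" "\<sigma>' \<in> facets \<P>"
    and "\<sigma> \<inter> \<sigma>' \<in> walls \<P>"
  shows "\<sigma> \<inter> \<sigma>' \<in> interior_walls \<P>"
proof -
  have "\<sigma> \<noteq> \<sigma>'"
    using assms by (auto simp: pure_full_dim_def faces_of_dim_def)
  moreover have "(\<sigma> \<inter> \<sigma>') face_of \<sigma>" "(\<sigma> \<inter> \<sigma>') face_of \<sigma>'"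
    using assms by (auto simp: polytopal_complex_def facets_def)
  ultimately show ?thesis
    using assms by (auto simp: interior_walls_def)
qed

text \<open>A wall shared by two facets is a face of their intersection, which is a proper face of
  \<open>\<sigma>\<close> and so has dimension at most n-1. A proper face of it would be too small
  to be a wall.\<close>

lemma interior_wall_eq_Int:
  fixes \<P> :: "'a::euclidean_space set set"
  assumes cplx: "polytopal_complex \<P>" and pure: "pure_full_dim \<P>" and "\<tau> \<in> interior_walls \<P>"
  obtains \<sigma> \<sigma>' where "\<sigma> \<in> facets \<P>" "\<sigma>' \<in> facets \<P>" "\<tau> = \<sigma> \<inter> \<sigma>'"
proof -
  obtain \<sigma> \<sigma>' where \<sigma>: "\<sigma> \<in> facets \<P>" "\<sigma>' \<in> facets \<P>" "\<sigma> \<noteq> \<sigma>'" "\<tau> face_of \<sigma>" "\<tau> face_of \<sigma>'"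
      and \<tau>: "aff_dim \<tau> = int DIM('a) - 1"
    using assms(3) by (auto simp: interior_walls_def faces_of_dim_def)
  have mem: "\<sigma> \<in> \<P>" "\<sigma>' \<in> \<P>"
    using \<sigma> by (auto simp: facets_def)
  have face: "(\<sigma> \<inter> \<sigma>') face_of \<sigma>" and conv: "convex \<sigma>" "convex (\<sigma> \<inter> \<sigma>')"
    using cplx mem by (auto simp: polytopal_complex_def polytope_imp_convex convex_Int)
  \<comment> \<open>Otherwise \<open>\<sigma>\<close> would lie in \<open>\<sigma>'\<close>, against
    its maximality.\<close>
  have "\<sigma> \<inter> \<sigma>' \<noteq> \<sigma>"
    using \<sigma> mem by (auto simp: facets_def)
  then have "aff_dim (\<sigma> \<inter> \<sigma>') < aff_dim \<sigma>"
    by (rule face_of_aff_dim_lt[OF conv(1) face])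
  then have lt: "aff_dim (\<sigma> \<inter> \<sigma>') \<le> int DIM('a) - 1"
    using pure \<sigma>(1) by (simp add: pure_full_dim_def)
  have sub: "\<tau> face_of (\<sigma> \<inter> \<sigma>')"
    using \<sigma>(4,5) by (intro face_of_subset[OF \<sigma>(4)]) (auto dest: face_of_imp_subset)
  have "\<tau> = \<sigma> \<inter> \<sigma>'"
  proof (rule ccontr)
    assume "\<tau> \<noteq> \<sigma> \<inter> \<sigma>'"
    with face_of_aff_dim_lt[OF conv(2) sub] lt \<tau> show False by simp
  qed
  with \<sigma> that show thesis by blast
qed

text \<open>Reconciles the index set of the splines with the vertices of the graphs. An n-face
  strictly inside another member would be a proper face of it, whose dimension would then exceed
  n.\<close>

lemma top_faces_eq_facets:
  fixes \<P> :: "'a::euclidean_space set set"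
  assumes cplx: "polytopal_complex \<P>" and pure: "pure_full_dim \<P>"
  shows "top_faces \<P> = facets \<P>"
proof
  show "facets \<P> \<subseteq> top_faces \<P>"
    using pure by (auto simp: pure_full_dim_def faces_of_dim_def facets_def)
  show "top_faces \<P> \<subseteq> facets \<P>"
  proof
    fix \<sigma> assume "\<sigma> \<in> top_faces \<P>"
    then have \<sigma>: "\<sigma> \<in> \<P>" "aff_dim \<sigma> = int DIM('a)"
      by (auto simp: faces_of_dim_def)
    have "\<sigma> = \<sigma>'" if \<sigma>': "\<sigma>' \<in> \<P>" "\<sigma> \<subseteq> \<sigma>'" for \<sigma>'
    proof (rule ccontr)
      assume ne: "\<sigma> \<noteq> \<sigma>'"
      have "(\<sigma> \<inter> \<sigma>') face_of \<sigma>'" "convex \<sigma>'"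
        using cplx \<sigma> \<sigma>' by (auto simp: polytopal_complex_def polytope_imp_convex)
      moreover have "\<sigma> \<inter> \<sigma>' = \<sigma>"
        using \<sigma>'(2) by blast
      ultimately have "aff_dim \<sigma> < aff_dim \<sigma>'"
        using ne by (simp add: face_of_aff_dim_lt)
      with \<sigma>(2) aff_dim_le_DIM[of \<sigma>'] show False by simp
    qed
    with \<sigma> show "\<sigma> \<in> facets \<P>" by (auto simp: facets_def)
  qed
qed

text \<open>The ideal condition puts the hull inside the zero set of \<open>l \<tau>\<close>. That
  zero set is a hyperplane and the hull has dimension n-1, so the two coincide.\<close>

lemma defining_form_affine:
  fixes \<P> :: "(real ^ 'n::{finite,linorder}) set set"
  assumes l: "defining_forms \<P> l" and \<tau>: "\<tau> \<in> walls \<P>"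
  obtains v where "l \<tau> = affine_form v" "affine hull \<tau> = {x. v \<bullet> (x, 1) = 0}"
proof -
  have deg: "total_degree (l \<tau>) = 1"
    and ideal: "vanishing_ideal (affine hull \<tau>) = {q * l \<tau> | q. True}"
    using l \<tau> by (auto simp: defining_forms_def)
  obtain v where v: "l \<tau> = affine_form v"
    using total_degree_le_1_imp_affine_form[of "l \<tau>"] deg by (metis order_refl)
  have "1 * l \<tau> \<in> vanishing_ideal (affine hull \<tau>)"
    unfolding ideal by blast
  then have sub: "affine hull \<tau> \<subseteq> {x. v \<bullet> (x, 1) = 0}"
    by (auto simp: vanishing_ideal_def v mpoly_eval_affine_form)
  have dim: "aff_dim \<tau> = int CARD('n) - 1"
    using \<tau> by (simp add: faces_of_dim_def)
  \<comment> \<open>The empty face has dimension -1, whereas n-1 is at least 0 because the index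
    type is inhabited.\<close>
  have "\<tau> \<noteq> {}" using dim zero_less_card_finite[where 'a = 'n] by auto
  then have ne: "affine hull \<tau> \<noteq> {}" by simp
  have plane: "{x. v \<bullet> (x, 1) = 0} = {x. fst v \<bullet> x = - snd v}"
    by (auto simp: inner_prod_def)
  \<comment> \<open>A constant form vanishing on a nonempty hull is 0, and the zero polynomial has
    degree 0 by convention, not 1.\<close>
  have "fst v \<noteq> 0"
  proof
    assume "fst v = 0"
    with ne sub plane have "v = 0" by (auto simp: prod_eq_iff)
    then have "l \<tau> = 0" by (simp add: v affine_form_def)
    with deg show False by (simp add: total_degree_def)
  qed
  then have "aff_dim {x. v \<bullet> (x, 1) = 0} = aff_dim (affine hull \<tau>)"
    unfolding plane aff_dim_affine_hull dim by simp
  then have "affine hull \<tau> = {x. v \<bullet> (x, 1) = 0}"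
    using sub ne affine_hyperplane[of "fst v" "- snd v"]
    by (intro affine_dim_equal) (auto simp flip: plane)
  with v that show thesis by blast
qed

lemma form_in_vanishing_ideal_iff:
  fixes \<P> :: "(real ^ 'n::{finite,linorder}) set set"
  assumes "defining_forms \<P> l" "\<tau> \<in> walls \<P>"
  shows "l \<tau> \<in> vanishing_ideal W \<longleftrightarrow> W \<subseteq> affine hull \<tau>"
  by (rule defining_form_affine[OF assms])
    (auto simp: vanishing_ideal_def mpoly_eval_affine_form)

section \<open>The flat attached to a prime ideal\<close>

lemma ex_flat_of_prime:
  fixes \<P> :: "(real ^ 'n::{finite,linorder}) set set"
  assumes l: "defining_forms \<P> l" and P: "prime_ideal P"
  shows "\<exists>W\<in>flats \<P>. \<forall>\<tau>\<in>interior_walls \<P>. l \<tau> \<in> vanishing_ideal W \<longleftrightarrow> l \<tau> \<in> P"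
proof -
  have walls: "\<tau> \<in> walls \<P>" if "\<tau> \<in> interior_walls \<P>" for \<tau>
    using that by (simp add: interior_walls_def)
  have "\<exists>v. l \<tau> = affine_form v \<and> affine hull \<tau> = {x. v \<bullet> (x, 1) = 0}"
    if "\<tau> \<in> interior_walls \<P>" for \<tau>
    using defining_form_affine[OF l walls[OF that]] by blast
  then obtain v where v: "\<And>\<tau>. \<tau> \<in> interior_walls \<P> \<Longrightarrow> l \<tau> = affine_form (v \<tau>)"
      and hull: "\<And>\<tau>. \<tau> \<in> interior_walls \<P> \<Longrightarrow> affine hull \<tau> = {x. v \<tau> \<bullet> (x, 1) = 0}"
    by metis
  define T where "T = {\<tau> \<in> interior_walls \<P>. l \<tau> \<in> P}"
  define W where "W = (\<Inter>\<tau>\<in>T. affine hull \<tau>)"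
  have W_iff: "x \<in> W \<longleftrightarrow> (\<forall>w\<in>v ` T. w \<bullet> (x, 1) = 0)" for x
    by (auto simp: W_def T_def hull)
  have span: "affine_form w \<in> P" if "w \<in> span (v ` T)" for w
    using that by (rule affine_form_in_span_in_ideal[OF P, rotated]) (auto simp: T_def simp flip: v)
  \<comment> \<open>An inconsistent system would put the constant 1 into \<open>P\<close>, so
    \<open>W\<close> has a point. For empty \<open>T\<close> the flat is the whole space.\<close>
  have "affine_form (0, 1) = (1 :: 'n mpoly)"
    by (simp add: affine_form_def)
  then have "(0, 1) \<notin> span (v ` T)"
    using span prime_ideal_one[OF P] by metis
  then obtain z where z: "z \<in> W"
    using one_in_span_if_inconsistent[of "v ` T"] W_iff by blast
  show ?thesis
  proof (intro bexI ballI)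
    show "W \<in> flats \<P>"
      using z by (auto simp: flats_def W_def T_def)
    fix \<tau> assume \<tau>: "\<tau> \<in> interior_walls \<P>"
    show "l \<tau> \<in> vanishing_ideal W \<longleftrightarrow> l \<tau> \<in> P"
      unfolding form_in_vanishing_ideal_iff[OF l walls[OF \<tau>]]
    proof
      \<comment> \<open>Since \<open>W\<close> is nonempty, a form vanishing on it is a linear
        combination of its equations, all of which lie in \<open>P\<close>.\<close>
      assume sub: "W \<subseteq> affine hull \<tau>"
      have "v \<tau> \<in> span (v ` T)"
      proof (rule affine_function_in_span)
        show "w \<bullet> (z, 1) = 0" if "w \<in> v ` T" for w
          using z that W_iff by blast
        show "v \<tau> \<bullet> (x, 1) = 0" if "\<And>w. w \<in> v ` T \<Longrightarrow> w \<bullet> (x, 1) = 0" for x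
          using sub that hull[OF \<tau>] W_iff by blast
      qed
      then show "l \<tau> \<in> P" using span v[OF \<tau>] by simp
    next
      assume "l \<tau> \<in> P"
      then show "W \<subseteq> affine hull \<tau>" using \<tau> by (auto simp: W_def T_def)
    qed
  qed
qed


section \<open>The graphs\<close>

text \<open>One formula covers both branches of \<open>graph_at\<close>: the wall of an edge is
  interior, so if no interior wall has its form in \<open>J\<close>, the set on the right is empty
  as well.\<close>

lemma adj_graph_at:
  assumes "polytopal_complex \<P>" "pure_full_dim \<P>"
  shows "adj (graph_at \<P> l J) = {(\<sigma>, \<sigma>'). \<sigma> \<in> facets \<P> \<and> \<sigma>' \<in> facets \<P> \<and>
           \<sigma> \<inter> \<sigma>' \<in> walls \<P> \<and> l (\<sigma> \<inter> \<sigma>') \<in> J}"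
  using facets_Int_wall[OF assms] by (auto simp: graph_at_def)

lemma verts_graph_at: "verts (graph_at \<P> l J) \<subseteq> facets \<P>"
  by (auto simp: graph_at_def)

lemma adj_graph_at_subset_verts:
  assumes "polytopal_complex \<P>" "pure_full_dim \<P>"
  shows "adj (graph_at \<P> l J) \<subseteq> verts (graph_at \<P> l J) \<times> verts (graph_at \<P> l J)"
proof (intro subrelI SigmaI)
  fix \<sigma> \<sigma>' assume "(\<sigma>, \<sigma>') \<in> adj (graph_at \<P> l J)"
  then have *: "\<sigma> \<in> facets \<P>" "\<sigma>' \<in> facets \<P>" "\<sigma> \<inter> \<sigma>' \<in> interior_walls \<P>" "l (\<sigma> \<inter> \<sigma>') \<in> J"
    using facets_Int_wall[OF assms] unfolding adj_graph_at[OF assms] by auto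
  moreover have "(\<sigma> \<inter> \<sigma>') face_of \<sigma>" "(\<sigma> \<inter> \<sigma>') face_of \<sigma>'"
    using assms(1) * by (auto simp: polytopal_complex_def facets_def)
  ultimately show "\<sigma> \<in> verts (graph_at \<P> l J)" "\<sigma>' \<in> verts (graph_at \<P> l J)"
    by (auto simp: graph_at_def)
qed

lemma sym_adj_graph_at: "sym (adj (graph_at \<P> l J))"
  by (auto simp: graph_at_def sym_def Int_commute)

text \<open>Every interior wall is the intersection of two facets, and these are adjacent exactly
  when its form lies in the ideal. So the edges recover these memberships, which in turn determine
  the graph.\<close>

lemma graph_at_eq_iff:
  assumes "polytopal_complex \<P>" "pure_full_dim \<P>"
  shows "graph_at \<P> l J = graph_at \<P> l J' \<longleftrightarrow>
    (\<forall>\<tau>\<in>interior_walls \<P>. l \<tau> \<in> J \<longleftrightarrow> l \<tau> \<in> J')"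
proof
  have edge: "l \<tau> \<in> K \<longleftrightarrow> (\<exists>\<sigma> \<sigma>'. \<tau> = \<sigma> \<inter> \<sigma>' \<and> (\<sigma>, \<sigma>') \<in> adj (graph_at \<P> l K))"
    if \<tau>: "\<tau> \<in> interior_walls \<P>" for \<tau> K
  proof -
    obtain \<sigma> \<sigma>' where "\<sigma> \<in> facets \<P>" "\<sigma>' \<in> facets \<P>" "\<tau> = \<sigma> \<inter> \<sigma>'"
      using interior_wall_eq_Int[OF assms \<tau>] .
    then show ?thesis
      using \<tau> unfolding adj_graph_at[OF assms] interior_walls_def by blast
  qed
  assume "graph_at \<P> l J = graph_at \<P> l J'"
  then show "\<forall>\<tau>\<in>interior_walls \<P>. l \<tau> \<in> J \<longleftrightarrow> l \<tau> \<in> J'"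
    using edge by metis
next
  assume *: "\<forall>\<tau>\<in>interior_walls \<P>. l \<tau> \<in> J \<longleftrightarrow> l \<tau> \<in> J'"
  then have "adj (graph_at \<P> l J) = adj (graph_at \<P> l J')"
    using facets_Int_wall[OF assms] by (auto simp: adj_graph_at[OF assms])
  moreover have "verts (graph_at \<P> l J) = verts (graph_at \<P> l J')"
    using * by (auto simp: graph_at_def)
  ultimately show "graph_at \<P> l J = graph_at \<P> l J'"
    by (intro ugraph.equality) auto
qed

lemma flat_eqI:
  fixes \<P> :: "(real ^ 'n::{finite,linorder}) set set"
  assumes l: "defining_forms \<P> l" and W: "W \<in> flats \<P>" "W' \<in> flats \<P>"
    and same: "\<And>\<tau>. \<tau> \<in> interior_walls \<P> \<Longrightarrow>
      l \<tau> \<in> vanishing_ideal W \<longleftrightarrow> l \<tau> \<in> vanishing_ideal W'"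
  shows "W = W'"
proof -
  \<comment> \<open>A flat is the intersection of all wall hyperplanes that contain it, a canonical
    choice among the families defining it.\<close>
  have "V = (\<Inter>\<tau>\<in>{\<tau> \<in> interior_walls \<P>. V \<subseteq> affine hull \<tau>}. affine hull \<tau>)"
    if "V \<in> flats \<P>" for V
    using that by (auto simp: flats_def)
  moreover have "W \<subseteq> affine hull \<tau> \<longleftrightarrow> W' \<subseteq> affine hull \<tau>" if "\<tau> \<in> interior_walls \<P>" for \<tau>
    using same[OF that] that
    by (simp add: interior_walls_def form_in_vanishing_ideal_iff[OF l])
  ultimately show ?thesis
    using W by (smt (verit) Collect_cong)
qed

section \<open>Splines on the graph and their localization\<close>

text \<open>Edges never leave a component and tuples on different components have disjoint supports,
  so the sum over components amounts to imposing all edge conditions at once.\<close>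

lemma graph_splines_eq:
  assumes fin: "finite (verts G)" and sub: "adj G \<subseteq> verts G \<times> verts G" and sym: "sym (adj G)"
  shows "graph_splines r l G = {F \<in> tuples UNIV (verts G).
     \<forall>(\<sigma>, \<sigma>')\<in>adj G. l (\<sigma> \<inter> \<sigma>') ^ (r + 1) dvd F \<sigma> - F \<sigma>'}"
proof -
  define E where "E = {(u, v). u \<in> verts G \<and> v \<in> verts G \<and> (u, v) \<in> (adj G)\<^sup>*}"
  have eq: "equiv (verts G) E"
    unfolding E_def
    by (auto simp: equiv_def refl_on_def sym_def trans_def intro: rtrancl_trans)
      (metis sym sym_rtrancl symD)
  have comp: "graph_components G = verts G // E"
    by (simp add: graph_components_def E_def)
  have finC: "finite (graph_components G)"
    unfolding comp using fin by (simp add: quotient_def)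
  \<comment> \<open>Components are disjoint, so only the one containing \<open>\<sigma>\<close>
    contributes.\<close>
  have sum: "(\<Sum>K\<in>graph_components G. F K \<sigma>) = F K0 \<sigma>"
    if F: "\<And>K. K \<in> graph_components G \<Longrightarrow> F K \<in> tuples UNIV K"
      and K0: "K0 \<in> graph_components G" "\<sigma> \<in> K0" for F :: "_ \<Rightarrow> _ \<Rightarrow> 'a mpoly" and K0 \<sigma>
  proof -
    have "F K \<sigma> = 0" if "K \<in> graph_components G - {K0}" for K
    proof -
      have "\<sigma> \<notin> K"
        using that K0 quotient_disj[OF eq, of K K0] by (auto simp: comp)
      then show ?thesis
        using F[of K] that by (auto simp: tuples_def)
    qed
    then show ?thesis
      by (simp add: sum.remove[OF finC K0(1)])
  qed
  have cov: "\<exists>K\<in>graph_components G. \<sigma> \<in> K" if "\<sigma> \<in> verts G" for \<sigma>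
    using that Union_quotient[OF eq] unfolding comp by blast
  have subK: "K \<subseteq> verts G" if "K \<in> graph_components G" for K
    using that Union_quotient[OF eq] unfolding comp by blast
  have edge: "\<sigma>' \<in> K" if "K \<in> graph_components G" "\<sigma> \<in> K" "(\<sigma>, \<sigma>') \<in> adj G" for K \<sigma> \<sigma>'
    using that sub in_quotient_imp_closed[OF eq, of K \<sigma> \<sigma>'] by (auto simp: comp E_def)
  show ?thesis
  proof (intro Set.set_eqI iffI)
    fix H assume "H \<in> graph_splines r l G"
    then obtain F where H: "H = (\<lambda>\<sigma>. \<Sum>K\<in>graph_components G. F K \<sigma>)"
        and F: "\<And>K. K \<in> graph_components G \<Longrightarrow> F K \<in> component_splines r l G K"
      by (auto simp: graph_splines_def)
    have FT: "F K \<in> tuples UNIV K" if "K \<in> graph_components G" for K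
      using F[OF that] by (simp add: component_splines_def)
    have HF: "H \<sigma> = F K \<sigma>" if "K \<in> graph_components G" "\<sigma> \<in> K" for K \<sigma>
      unfolding H using FT that by (rule sum)
    have "H \<sigma> = 0" if "\<sigma> \<notin> verts G" for \<sigma>
      unfolding H
    proof (rule sum.neutral, rule ballI)
      fix K assume K: "K \<in> graph_components G"
      then show "F K \<sigma> = 0" using FT[OF K] subK[OF K] that by (auto simp: tuples_def)
    qed
    moreover have "l (\<sigma> \<inter> \<sigma>') ^ (r + 1) dvd H \<sigma> - H \<sigma>'" if e: "(\<sigma>, \<sigma>') \<in> adj G" for \<sigma> \<sigma>'
    proof -
      obtain K where K: "K \<in> graph_components G" "\<sigma> \<in> K"
        using cov e sub by blast
      have "\<sigma>' \<in> K" using edge[OF K e] .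
      then show ?thesis
        using F[OF K(1)] K e HF[OF K(1)] by (auto simp: component_splines_def)
    qed
    ultimately show "H \<in> {F \<in> tuples UNIV (verts G).
        \<forall>(\<sigma>, \<sigma>')\<in>adj G. l (\<sigma> \<inter> \<sigma>') ^ (r + 1) dvd F \<sigma> - F \<sigma>'}"
      by (auto simp: tuples_def)
  next
    fix H assume H: "H \<in> {F \<in> tuples UNIV (verts G).
        \<forall>(\<sigma>, \<sigma>')\<in>adj G. l (\<sigma> \<inter> \<sigma>') ^ (r + 1) dvd F \<sigma> - F \<sigma>'}"
    \<comment> \<open>Cut \<open>H\<close> into its restrictions. The conditions on \<open>K\<close>
      only compare indices in \<open>K\<close>, where \<open>F K\<close> agrees with
      \<open>H\<close>.\<close>
    define F where "F K \<sigma> = (if \<sigma> \<in> K then H \<sigma> else 0)" for K \<sigma>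
    have "F K \<in> component_splines r l G K" for K
      using H by (auto simp: F_def component_splines_def tuples_def)
    moreover have "H = (\<lambda>\<sigma>. \<Sum>K\<in>graph_components G. F K \<sigma>)"
    proof
      fix \<sigma>
      show "H \<sigma> = (\<Sum>K\<in>graph_components G. F K \<sigma>)"
      proof (cases "\<sigma> \<in> verts G")
        case True
        then obtain K where K: "K \<in> graph_components G" "\<sigma> \<in> K"
          using cov by blast
        then show ?thesis
          by (subst sum[OF _ K]) (auto simp: F_def tuples_def)
      next
        case False
        then have "F K \<sigma> = 0" if "K \<in> graph_components G" for K
          using subK[OF that] by (auto simp: F_def)
        with False show ?thesis
          using H by (simp add: tuples_def)
      qed
    qed
    ultimately show "H \<in> graph_splines r l G"
      by (auto simp: graph_splines_def)
  qed
qed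

text \<open>The criterion \<open>is_direct_sum_local_module\<close> is applied with the vertices of
  the graph as \<open>V\<close> and the remaining facets as \<open>S\<close>. If no form of an
  interior wall lies in \<open>P\<close>, every facet is a vertex and the second index set is
  empty.\<close>

lemma local_splines_direct_sum:
  fixes \<P> :: "(real ^ 'n::{finite,linorder}) set set"
  assumes cplx: "polytopal_complex \<P>" and pure: "pure_full_dim \<P>" and P: "prime_ideal P"
  shows "is_direct_sum
     (local_module P (splines r \<P> l))
     (local_module P (graph_splines r l (graph_at \<P> l P)))
     (tuples (local_ring P) (top_faces \<P> - verts (graph_at \<P> l P)))"
proof -
  define G where "G = graph_at \<P> l P"
  define I where "I = {\<tau> \<in> interior_walls \<P>. l \<tau> \<notin> P}"
  define u where "u = (\<Prod>\<tau>\<in>I. l \<tau> ^ (r + 1))"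
  note top = top_faces_eq_facets[OF cplx pure]
  have finP: "finite \<P>"
    using cplx by (simp add: polytopal_complex_def)
  have fin: "finite (facets \<P>)"
    by (rule finite_subset[OF _ finP]) (auto simp: facets_def)
  have finI: "finite I"
    by (rule finite_subset[OF _ finP]) (auto simp: I_def interior_walls_def faces_of_dim_def)
  have V: "verts G \<subseteq> facets \<P>"
    by (simp add: G_def verts_graph_at)
  have adj: "adj G = {(\<sigma>, \<sigma>'). \<sigma> \<in> facets \<P> \<and> \<sigma>' \<in> facets \<P> \<and>
      \<sigma> \<inter> \<sigma>' \<in> walls \<P> \<and> l (\<sigma> \<inter> \<sigma>') \<in> P}"
    by (simp add: G_def adj_graph_at[OF cplx pure])
  have sub: "adj G \<subseteq> verts G \<times> verts G"
    unfolding G_def by (rule adj_graph_at_subset_verts[OF cplx pure])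
  have gs: "graph_splines r l G = {F \<in> tuples UNIV (verts G).
     \<forall>(\<sigma>, \<sigma>')\<in>adj G. l (\<sigma> \<inter> \<sigma>') ^ (r + 1) dvd F \<sigma> - F \<sigma>'}"
    by (rule graph_splines_eq[OF finite_subset[OF V fin] sub]) (simp add: G_def sym_adj_graph_at)
  have "is_direct_sum (local_module P (splines r \<P> l)) (local_module P (graph_splines r l G))
      (local_module P (tuples UNIV (top_faces \<P> - verts G)))"
  proof (rule is_direct_sum_local_module[OF P])
    show "u \<notin> P"
      unfolding u_def by (intro prime_ideal_prod prime_ideal_power P) (simp add: I_def)
    show "(top_faces \<P> - verts G) \<inter> verts G = {}" by blast
    show "graph_splines r l G \<subseteq> tuples UNIV (verts G)" "(\<lambda>\<sigma>. 0) \<in> graph_splines r l G"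
      by (auto simp: gs tuples_def)
    show "(\<lambda>\<sigma>. if \<sigma> \<in> verts G then F \<sigma> else 0) \<in> graph_splines r l G \<and>
        (\<forall>\<sigma>. \<sigma> \<notin> verts G \<union> (top_faces \<P> - verts G) \<longrightarrow> F \<sigma> = 0)"
      if F: "F \<in> splines r \<P> l" for F
    proof -
      have "l (\<sigma> \<inter> \<sigma>') ^ (r + 1) dvd F \<sigma> - F \<sigma>'" if "(\<sigma>, \<sigma>') \<in> adj G" for \<sigma> \<sigma>'
        using F that unfolding splines_def adj top by blast
      moreover have "\<sigma> \<in> verts G" "\<sigma>' \<in> verts G" if "(\<sigma>, \<sigma>') \<in> adj G" for \<sigma> \<sigma>'
        using that sub by auto
      ultimately show ?thesis
        using F unfolding gs by (auto simp: tuples_def splines_def)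
    qed
    show "(\<lambda>\<sigma>. u * (a * F \<sigma> + b * H \<sigma>)) \<in> splines r \<P> l"
      if F: "F \<in> graph_splines r l G" and H: "H \<in> tuples UNIV (top_faces \<P> - verts G)" for F H a b
    proof -
      have "l (\<sigma> \<inter> \<sigma>') ^ (r + 1) dvd u * (a * F \<sigma> + b * H \<sigma>) - u * (a * F \<sigma>' + b * H \<sigma>')"
        if \<sigma>: "\<sigma> \<in> facets \<P>" "\<sigma>' \<in> facets \<P>" "\<sigma> \<inter> \<sigma>' \<in> walls \<P>" for \<sigma> \<sigma>'
      proof (cases "l (\<sigma> \<inter> \<sigma>') \<in> P")
        case True
        \<comment> \<open>Both facets are vertices of the graph, so \<open>H\<close> vanishes there
          and only the edge condition on \<open>F\<close> matters.\<close>
        then have e: "(\<sigma>, \<sigma>') \<in> adj G" using \<sigma> by (simp add: adj)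
        then have "H \<sigma> = 0" "H \<sigma>' = 0"
          using sub H by (auto simp: tuples_def)
        then have "u * (a * F \<sigma> + b * H \<sigma>) - u * (a * F \<sigma>' + b * H \<sigma>') =
            (u * a) * (F \<sigma> - F \<sigma>')"
          by (simp add: algebra_simps)
        moreover have "l (\<sigma> \<inter> \<sigma>') ^ (r + 1) dvd F \<sigma> - F \<sigma>'"
          using F e unfolding gs by blast
        ultimately show ?thesis by (metis dvd_mult)
      next
        case False
        \<comment> \<open>This wall contributes the factor
          \<open>l (\<sigma> \<inter> \<sigma>') ^ (r + 1)\<close> to \<open>u\<close>, so the
          condition holds whatever the values of \<open>F\<close> and \<open>H\<close>.\<close>
        then have "\<sigma> \<inter> \<sigma>' \<in> I"
          using facets_Int_wall[OF cplx pure \<sigma>] by (simp add: I_def)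
        then have "l (\<sigma> \<inter> \<sigma>') ^ (r + 1) dvd u"
          unfolding u_def by (rule dvd_prodI[OF finI])
        then show ?thesis by (meson dvd_diff dvd_mult2)
      qed
      moreover have "F \<sigma> = 0" "H \<sigma> = 0" if "\<sigma> \<notin> facets \<P>" for \<sigma>
        using F H that V unfolding gs top by (auto simp: tuples_def)
      ultimately show ?thesis
        unfolding splines_def top by (auto simp: tuples_def)
    qed
  qed
  moreover have "finite (top_faces \<P> - verts G)"
    using fin unfolding top by simp
  ultimately show ?thesis
    unfolding G_def by (simp add: tuples_local_ring[OF P])
qed

section \<open>Uniqueness of the flat and the two decompositions\<close>

theorem proposition3p5:
  fixes \<P> :: "(real ^ 'n::{finite,linorder}) set set"
    and r :: nat
    and P :: "'n mpoly set"
    and l :: "(real ^ 'n::{finite,linorder}) set \<Rightarrow> 'n mpoly"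
  assumes "polytopal_complex \<P>"
    and "pure_full_dim \<P>"
    and "hereditary \<P>"
    and "defining_forms \<P> l"
    and "prime_ideal P"
  shows "(\<exists>!W. W \<in> flats \<P> \<and> graph_at \<P> l (vanishing_ideal W) = graph_at \<P> l P) \<and>
    (\<forall>W. W \<in> flats \<P> \<and> graph_at \<P> l (vanishing_ideal W) = graph_at \<P> l P \<longrightarrow>
       is_direct_sum
         (local_module P (splines r \<P> l))
         (local_module P (graph_splines r l (graph_at \<P> l P)))
         (tuples (local_ring P) (top_faces \<P> - verts (graph_at \<P> l P))) \<and>
       is_direct_sum
         (local_module P (splines r \<P> l))
         (local_module P (graph_splines r l (graph_at \<P> l (vanishing_ideal W))))
         (tuples (local_ring P) (top_faces \<P> - verts (graph_at \<P> l (vanishing_ideal W)))))"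
proof -
  let ?good = "\<lambda>W. W \<in> flats \<P> \<and> graph_at \<P> l (vanishing_ideal W) = graph_at \<P> l P"
  note iff = graph_at_eq_iff[OF assms(1,2), of l]
  obtain W where W: "W \<in> flats \<P>"
      "\<forall>\<tau>\<in>interior_walls \<P>. l \<tau> \<in> vanishing_ideal W \<longleftrightarrow> l \<tau> \<in> P"
    using bexE[OF ex_flat_of_prime[OF assms(4,5)]] .
  have "graph_at \<P> l (vanishing_ideal W) = graph_at \<P> l P"
    unfolding iff by (rule W(2))
  with W(1) have good: "?good W" by (rule conjI)
  show ?thesis
  proof (rule conjI[OF ex1I[of ?good, OF good]], goal_cases)
    case (1 V)
    \<comment> \<open>Equal graphs select the same interior walls, and a flat is determined by the
      wall hyperplanes containing it.\<close>
    show "V = W"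
    proof (rule flat_eqI[OF assms(4) conjunct1[OF 1] W(1)])
      have "graph_at \<P> l (vanishing_ideal V) = graph_at \<P> l (vanishing_ideal W)"
        by (rule trans[OF conjunct2[OF 1] conjunct2[OF good, symmetric]])
      then show "\<tau> \<in> interior_walls \<P> \<Longrightarrow> l \<tau> \<in> vanishing_ideal V \<longleftrightarrow> l \<tau> \<in> vanishing_ideal W"
        for \<tau>
        unfolding iff by (rule bspec)
    qed
  next
    case 2
    show ?case
    proof (intro allI impI)
      fix V assume V: "?good V"
      \<comment> \<open>Once the graph at \<open>V\<close> is replaced by the equal graph at
        \<open>P\<close>, both decompositions are the same statement.\<close>
      note sum = local_splines_direct_sum[OF assms(1,2,5), of r l]
      from sum sum show "is_direct_sum
         (local_module P (splines r \<P> l))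
         (local_module P (graph_splines r l (graph_at \<P> l P)))
         (tuples (local_ring P) (top_faces \<P> - verts (graph_at \<P> l P))) \<and>
       is_direct_sum
         (local_module P (splines r \<P> l))
         (local_module P (graph_splines r l (graph_at \<P> l (vanishing_ideal V))))
         (tuples (local_ring P) (top_faces \<P> - verts (graph_at \<P> l (vanishing_ideal V))))"
        unfolding conjunct2[OF V] by (rule conjI)
    qed
  qed
qed

end
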